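(* Assume that there are constants $\eta_{\mathrm{core}},\Delta_{\mathrm{core}}\ge0$ such that for every intrinsic package $\mathcal D$ there exists $\zeta_\ast=\zeta_\ast(\mathcal D)\in\Gamma_\Lambda^{\mathrm{int}}$ with $$\operatorname{dist}^{\sharp,\mathrm{tail}}(\mathcal D)=\|\mathcal D-\zeta_\ast\|_{\mathrm{loc,int}}+\alpha_{\mathrm{proj}}\mathcal T_{\mathrm{proj}}(\mathcal D;\zeta_\ast)+\alpha_{\mathrm{harm}}\mathcal T_{\mathrm{harm}}(\mathcal D;\zeta_\ast)$$ and $$2C_\eta\|u_{\zeta_\ast}\|_{L^3(I;L^3(A_{3/4,1}))}^2+C_{\mathrm{Riesz}}\|M^{\mathrm{act}}_{\zeta_\ast}\|_{L^{3/2}(I;L^{3/2}(B_1))^{3\times3}}\le\eta_{\mathrm{core}}\operatorname{dist}^{\sharp,\mathrm{tail}}(\mathcal D)+\Delta_{\mathrm{core}}.$$ Then every intrinsic package $\mathcal D$ satisfies $$\mathsf{Err}_{\mathrm{src,int}}^{\mathrm{prs}}(\mathcal D)\le\Big(\eta_{\mathrm{core}}+\max\{\alpha_{\mathrm{proj}}^{-1},\alpha_{\mathrm{harm}}^{-1}\}\Big)\operatorname{dist}^{\sharp,\mathrm{tail}}(\mathcal D)+\Delta_{\mathrm{core}}.$$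
   Context: Intrinsic packages. $\Lambda$ is a finite set of consecutive integers. For $k\in\Lambda$, $j=1,\dots,7$, let $X_k^{(j)}$ be normed spaces (velocity, active pressure, covariance, flux, energy/trace, selected trace, slack); an intrinsic package is $\mathcal D=(x_k^{(j)})_{k,j}$, $x_k^{(j)}\in X_k^{(j)}$, with norm $\|\mathcal D\|_{\mathrm{loc,int}}^2=\sum_{k}\sum_{j}a_j\|x_k^{(j)}\|^2$, $a_j>0$ fixed. $\Gamma_\Lambda^{\mathrm{int}}$ is a linear subspace of the space of intrinsic packages. Pressure geometry. $B_r\subset\mathbb R^3$ is the ball of radius $r$ about $0$, $I=(-1,0)$, $A_{3/4,1}=B_1\setminus B_{3/4}$, $\eta\in C_c^\infty(B_1)$ with $\eta\equiv1$ on $B_{3/4}$, $Y_{\mathrm{prs}}=L^{3/2}(I;L^{3/2}(B_{1/2}))$. $\mathsf R_1,\mathsf R_2,\mathsf R_3$ are the Riesz transforms on $\mathbb R^3$ (acting in space at each time); tensors on $B_1$ are extended by zero before applying them, repeated indices are summed, and results are restricted to $B_{1/2}$ when measured in $Y_{\mathrm{prs}}$. Each intrinsic package $\mathcal D$ carries normalized data: a velocity $u(\mathcal D)\in L^3(I;L^3(B_1))^3$, linear in $\mathcal D$, clean coordinates $U(\mathcal D),R(\mathcal D)$ giving the clean source $F_{ij}^{\mathrm{cl}}=U_iU_j+R_{ij}\in L^{3/2}(I;L^{3/2}(B_1))$, and a harmonic pressure component $p_{\mathrm{harm}}(\mathcal D)$ in a normed space $Y_{\mathrm{harm}}$. Put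 $f_{ij}=u_iu_j$ and $M_{ij}^{\mathrm{act}}=\eta f_{ij}-F_{ij}^{\mathrm{cl}}$. A subscript $\zeta$ means evaluation at $\mathcal D-\zeta$, $\zeta\in\Gamma_\Lambda^{\mathrm{int}}$. $P_{\mathrm{prs},N}^{\mathrm{cl}}:Y_{\mathrm{prs}}\to Y_{\mathrm{prs}}$ is a bounded linear projection. $\Pi_{\mathrm{harm},M}$ is a bounded projection of $Y_{\mathrm{harm}}$ onto a finite-dimensional subspace and $J_{\mathrm{harm}}:Y_{\mathrm{harm}}\to Y_{\mathrm{prs}}$ is a bounded linear map (the identity if $Y_{\mathrm{harm}}$ is already $Y_{\mathrm{prs}}$). The pressure-source mismatch is $$\mathfrak P_{\mathrm{src}}=\mathsf R_i\mathsf R_j(\eta f_{ij})-P_{\mathrm{prs},N}^{\mathrm{cl}}\mathsf R_i\mathsf R_j(F_{ij}^{\mathrm{cl}})-J_{\mathrm{harm}}(I-\Pi_{\mathrm{harm},M})p_{\mathrm{harm}},$$ and $\mathsf{Err}_{\mathrm{src,int}}^{\mathrm{prs}}(\mathcal D)=\inf_{\zeta\in\Gamma_\Lambda^{\mathrm{int}}}\|\mathfrak P_{\mathrm{src}}(\mathcal D-\zeta)\|_{Y_{\mathrm{prs}}}$. Constants: $C_\eta<\infty$, depending only on the cutoff and balls, is such that $\|\mathsf R_i\mathsf R_j(\eta v_iv_j)-\eta\mathsf R_i\mathsf R_j(v_iv_j)\|_{Y_{\mathrm{prs}}}\le C_\eta\|v\|^2_{L^3(I;L^3(A_{3/4,1}))}$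 for all $v\in L^3(I;L^3(B_1))^3$; $C_{\mathrm{Riesz}}<\infty$ is such that $\|\mathsf R_i\mathsf R_j(M_{ij})\|_{Y_{\mathrm{prs}}}\le C_{\mathrm{Riesz}}\|M\|_{L^{3/2}(I;L^{3/2}(B_1))^{3\times3}}$. Tails: $\mathcal T_{\mathrm{proj}}(\mathcal D;\zeta)=(1+\|P_{\mathrm{prs},N}^{\mathrm{cl}}\|)\|\mathsf R_i\mathsf R_j(F_{\zeta,ij}^{\mathrm{cl}})\|_{Y_{\mathrm{prs}}}$ and $\mathcal T_{\mathrm{harm}}(\mathcal D;\zeta)=\|J_{\mathrm{harm}}\|\,\|(I-\Pi_{\mathrm{harm},M})p_{\mathrm{harm},\zeta}\|_{Y_{\mathrm{harm}}}$. For fixed $\alpha_{\mathrm{proj}},\alpha_{\mathrm{harm}}>0$, $$\operatorname{dist}^{\sharp,\mathrm{tail}}(\mathcal D)=\inf_{\zeta\in\Gamma_\Lambda^{\mathrm{int}}}\big(\|\mathcal D-\zeta\|_{\mathrm{loc,int}}+\alpha_{\mathrm{proj}}\mathcal T_{\mathrm{proj}}(\mathcal D;\zeta)+\alpha_{\mathrm{harm}}\mathcal T_{\mathrm{harm}}(\mathcal D;\zeta)\big).$$ *)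

theory Defs
  imports "HOL-Analysis.Analysis"
begin

text \<open>Functions are representatives defined on the whole space; only their values on \<open>S\<close> matter.
  Vectors and tensors are measured by their pointwise Euclidean (Frobenius) norm.\<close>

definition Lp_fun :: "real \<Rightarrow> 'a::euclidean_space set \<Rightarrow> ('a \<Rightarrow> 'b::euclidean_space) set" where
  "Lp_fun p S = {f. set_borel_measurable lborel S f \<and> set_integrable lborel S (\<lambda>z. norm (f z) powr p)}"

definition Lp_norm :: "real \<Rightarrow> 'a::euclidean_space set \<Rightarrow> ('a \<Rightarrow> 'b::euclidean_space) \<Rightarrow> real" where
  "Lp_norm p S f = (LINT z:S|lborel. norm (f z) powr p) powr (1 / p)"

lemma Lp_fun_UNIV:
  "f \<in> Lp_fun p UNIV \<longleftrightarrow> f \<in> borel_measurable lborel \<and> integrable lborel (\<lambda>z. norm (f z) powr p)"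
  by (simp add: Lp_fun_def set_borel_measurable_def set_integrable_def)

lemma Lp_norm_UNIV: "Lp_norm p UNIV f = (LINT z|lborel. norm (f z) powr p) powr (1 / p)"
  by (simp add: Lp_norm_def set_lebesgue_integral_def)

lemma Lp_norm_nonneg: "0 \<le> Lp_norm p S f"
  by (simp add: Lp_norm_def)

lemma powr_convex_comb:
  fixes x y :: real
  assumes p: "1 \<le> p" and "0 \<le> x" "0 \<le> y" and s: "0 \<le> s" "0 \<le> t" "s + t = 1"
  shows "(s * x + t * y) powr p \<le> s * x powr p + t * y powr p"
proof -
  have le: "r powr p \<le> r" if "0 \<le> r" "r \<le> 1" for r :: real
    using powr_mono'[OF p that] that by simp
  have sle: "s \<le> 1" "t \<le> 1" using s by auto
  consider "x = 0" | "y = 0" | "0 < x" "0 < y" using assms by force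
  then show ?thesis
  proof cases
    case 1
    then show ?thesis using assms le[of t] sle by (simp add: powr_mult mult_right_mono)
  next
    case 2
    then show ?thesis using assms le[of s] sle by (simp add: powr_mult mult_right_mono)
  next
    case 3
    have st: "s = 1 - t" using s by simp
    show ?thesis unfolding st
      using convex_onD[OF powr_convex[OF p], of t x y] 3 s by simp
  qed
qed

lemma Lp_norm_powr:
  assumes "1 \<le> p"
  shows "(LINT z|lborel. norm (f z) powr p) = Lp_norm p UNIV f powr p"
proof -
  have "0 \<le> (LINT z|lborel. norm (f z) powr p)" by (intro integral_nonneg_AE) auto
  then show ?thesis using assms by (simp add: Lp_norm_UNIV powr_powr)
qed

lemma Lp_norm_eq_0:
  assumes "1 \<le> p" "f \<in> Lp_fun p UNIV"
  shows "Lp_norm p UNIV f = 0 \<longleftrightarrow> (AE z in lborel. f z = 0)"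
proof -
  have "Lp_norm p UNIV f = 0 \<longleftrightarrow> (LINT z|lborel. norm (f z) powr p) = 0"
    by (simp add: Lp_norm_UNIV)
  also have "\<dots> \<longleftrightarrow> (AE z in lborel. norm (f z) powr p = 0)"
    using assms by (intro integral_nonneg_eq_0_iff_AE) (auto simp: Lp_fun_UNIV)
  finally show ?thesis by simp
qed

lemma Lp_norm_cong_AE:
  assumes "AE z in lborel. f z = g z" "f \<in> Lp_fun p UNIV" "g \<in> Lp_fun p UNIV"
  shows "Lp_norm p UNIV f = Lp_norm p UNIV g"
proof -
  have "(LINT z|lborel. norm (f z) powr p) = (LINT z|lborel. norm (g z) powr p)"
    using assms by (intro integral_cong_AE) (auto simp: Lp_fun_UNIV)
  then show ?thesis by (simp add: Lp_norm_UNIV)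
qed

lemma Lp_scale:
  assumes "1 \<le> p" "f \<in> Lp_fun p UNIV"
  shows "(\<lambda>z. c *\<^sub>R f z) \<in> Lp_fun p UNIV"
    and "Lp_norm p UNIV (\<lambda>z. c *\<^sub>R f z) = \<bar>c\<bar> * Lp_norm p UNIV f"
proof -
  show "(\<lambda>z. c *\<^sub>R f z) \<in> Lp_fun p UNIV"
    using assms by (auto simp: Lp_fun_UNIV powr_mult)
  show "Lp_norm p UNIV (\<lambda>z. c *\<^sub>R f z) = \<bar>c\<bar> * Lp_norm p UNIV f"
    using assms by (simp add: Lp_norm_UNIV powr_mult powr_powr)
qed

lemma Lp_mult:
  fixes f :: "'a::euclidean_space \<Rightarrow> real"
  assumes "1 \<le> p" "f \<in> Lp_fun p UNIV"
  shows "(\<lambda>z. c * f z) \<in> Lp_fun p UNIV"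
    and "Lp_norm p UNIV (\<lambda>z. c * f z) = \<bar>c\<bar> * Lp_norm p UNIV f"
  using Lp_scale[OF assms, of c] by simp_all

lemma Lp_add:
  assumes p: "1 \<le> p" and f: "f \<in> Lp_fun p UNIV" and g: "g \<in> Lp_fun p UNIV"
  shows Lp_add_mem: "(\<lambda>z. f z + g z) \<in> Lp_fun p UNIV"
    and Lp_norm_triangle: "Lp_norm p UNIV (\<lambda>z. f z + g z) \<le> Lp_norm p UNIV f + Lp_norm p UNIV g"
proof -
  have pt: "norm (f z + g z) powr p \<le>
      (a + b) powr p * (a / (a + b) * (norm (f z) powr p / a powr p) + b / (a + b) * (norm (g z) powr p / b powr p))"
    if "0 < a" "0 < b" for a b z
  proof -
    have "(a + b) * (a / (a + b) * (norm (f z) / a) + b / (a + b) * (norm (g z) / b)) = norm (f z) + norm (g z)"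
    proof -
      have c: "(a + b) * (r / (a + b) * (x / r)) = x" if "0 < r" for r x
      proof -
        have "a + b \<noteq> 0" using \<open>0 < a\<close> \<open>0 < b\<close> by simp
        then have "(a + b) * (r / (a + b) * (x / r)) = r * (x / r)" by (metis mult.assoc nonzero_mult_div_cancel_left times_divide_eq_right)
        then show ?thesis using that by simp
      qed
      show ?thesis unfolding distrib_left[of "a + b"] c[OF \<open>0 < a\<close>] c[OF \<open>0 < b\<close>] ..
    qed
    then have "norm (f z + g z) powr p \<le> ((a + b) * (a / (a + b) * (norm (f z) / a) + b / (a + b) * (norm (g z) / b))) powr p"
      using that norm_triangle_ineq[of "f z" "g z"] p
      by (intro powr_mono2) auto
    also have "\<dots> = (a + b) powr p * (a / (a + b) * (norm (f z) / a) + b / (a + b) * (norm (g z) / b)) powr p"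
      using that by (subst powr_mult) auto
    also have "\<dots> \<le> (a + b) powr p * (a / (a + b) * (norm (f z) / a) powr p + b / (a + b) * (norm (g z) / b) powr p)"
    proof (intro mult_left_mono powr_convex_comb p)
      show "a / (a + b) + b / (a + b) = 1"
        using that by (simp add: add_divide_distrib[symmetric])
    qed (use that in auto)
    finally show ?thesis using that by (simp add: powr_divide)
  qed
  have int: "integrable lborel (\<lambda>z. C * (s * (norm (f z) powr p / a) + t * (norm (g z) powr p / b)))"
    for C s t a b
    using f g by (auto simp: Lp_fun_UNIV)
  have meas: "(\<lambda>z. norm (f z + g z) powr p) \<in> borel_measurable lborel"
    using f g by (auto simp: Lp_fun_UNIV)
  have I: "integrable lborel (\<lambda>z. norm (f z + g z) powr p)"
  proof (rule Bochner_Integration.integrable_bound[OF int meas])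
    show "AE z in lborel. norm (norm (f z + g z) powr p) \<le>
       norm ((1 + 1) powr p * (1 / (1 + 1) * (norm (f z) powr p / 1 powr p) + 1 / (1 + 1) * (norm (g z) powr p / 1 powr p)))"
      using pt[of 1 1] by (intro AE_I2) auto
  qed
  show mem: "(\<lambda>z. f z + g z) \<in> Lp_fun p UNIV"
    using I f g by (auto simp: Lp_fun_UNIV)
  let ?N = "Lp_norm p UNIV"
  show "?N (\<lambda>z. f z + g z) \<le> ?N f + ?N g"
  proof -
    consider "?N f = 0" | "?N g = 0" | "0 < ?N f" "0 < ?N g"
      using Lp_norm_nonneg[of p UNIV] by (metis less_eq_real_def)
    then show ?thesis
    proof cases
      case 1
      then have "AE z in lborel. f z + g z = g z" using Lp_norm_eq_0[OF p f] by simp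
      from Lp_norm_cong_AE[OF this mem g] 1 show ?thesis by simp
    next
      case 2
      then have "AE z in lborel. f z + g z = f z" using Lp_norm_eq_0[OF p g] by simp
      from Lp_norm_cong_AE[OF this mem f] 2 show ?thesis by simp
    next
      case 3
      define a b where "a = ?N f" and "b = ?N g"
      have ab: "0 < a" "0 < b" using 3 by (auto simp: a_def b_def)
      have If: "(LINT z|lborel. norm (f z) powr p) = a powr p"
        and Ig: "(LINT z|lborel. norm (g z) powr p) = b powr p"
        using Lp_norm_powr[OF p] by (auto simp: a_def b_def)
      have "(LINT z|lborel. norm (f z + g z) powr p) \<le>
        (LINT z|lborel. (a + b) powr p * (a / (a + b) * (norm (f z) powr p / a powr p) + b / (a + b) * (norm (g z) powr p / b powr p)))"
        by (intro integral_mono I int pt ab)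
      also have "\<dots> = (a + b) powr p * (a / (a + b) + b / (a + b))"
        using f g ab by (simp add: Lp_fun_UNIV If Ig)
      also have "\<dots> = (a + b) powr p" using ab by (simp add: add_divide_distrib[symmetric])
      finally have "?N (\<lambda>z. f z + g z) \<le> ((a + b) powr p) powr (1 / p)"
        unfolding Lp_norm_UNIV using p by (intro powr_mono2) (auto intro!: integral_nonneg_AE)
      then show ?thesis using p ab by (simp add: powr_powr a_def b_def)
    qed
  qed
qed

definition L32_rel :: "('a::euclidean_space \<Rightarrow> real) \<Rightarrow> ('a \<Rightarrow> real) \<Rightarrow> bool" where
  "L32_rel f g \<longleftrightarrow> f \<in> Lp_fun (3/2) UNIV \<and> g \<in> Lp_fun (3/2) UNIV \<and> (AE z in lborel. f z = g z)"

text \<open>The Banach space \<open>L\<^sup>3\<^sup>/\<^sup>2\<close> of real functions on a Euclidean space, modulo equality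
  almost everywhere.\<close>

quotient_type (overloaded) 'a L32 = "'a::euclidean_space \<Rightarrow> real" / partial: L32_rel
  morphisms rep_L32 L32_of
proof (rule part_equivpI)
  show "\<exists>f. L32_rel f (f :: 'a \<Rightarrow> real)"
    by (rule exI[of _ "\<lambda>_. 0"]) (simp add: L32_rel_def Lp_fun_UNIV)
  show "symp (L32_rel :: ('a \<Rightarrow> real) \<Rightarrow> _)"
    by (auto simp: symp_def L32_rel_def eq_commute)
  show "transp (L32_rel :: ('a \<Rightarrow> real) \<Rightarrow> _)"
    unfolding transp_def L32_rel_def by (auto elim: eventually_elim2)
qed

instantiation L32 :: (euclidean_space) real_normed_vector
begin

lift_definition zero_L32 :: "'a L32" is "\<lambda>_. 0"
  by (simp add: L32_rel_def Lp_fun_UNIV)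

lift_definition plus_L32 :: "'a L32 \<Rightarrow> 'a L32 \<Rightarrow> 'a L32" is "\<lambda>f g z. f z + g z"
  unfolding L32_rel_def by (auto intro: Lp_add_mem elim: eventually_elim2)

lift_definition scaleR_L32 :: "real \<Rightarrow> 'a L32 \<Rightarrow> 'a L32" is "\<lambda>c f z. c * f z"
  unfolding L32_rel_def by (auto intro: Lp_mult(1))

definition "uminus_L32 (f :: 'a L32) = (-1) *\<^sub>R f"
definition "minus_L32 (f :: 'a L32) g = f + - g"

lift_definition norm_L32 :: "'a L32 \<Rightarrow> real" is "Lp_norm (3/2) UNIV"
  unfolding L32_rel_def by (auto intro: Lp_norm_cong_AE)

definition "dist_L32 (f :: 'a L32) g = norm (f - g)"
definition "sgn_L32 (f :: 'a L32) = inverse (norm f) *\<^sub>R f"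
definition "uniformity_L32 = (INF e\<in>{0<..}. principal {(x, y :: 'a L32). dist x y < e})"
definition "open_L32 (U :: 'a L32 set) \<longleftrightarrow> (\<forall>x\<in>U. \<forall>\<^sub>F (x', y) in uniformity. x' = x \<longrightarrow> y \<in> U)"

instance
proof
  fix f g h :: "'a L32" and a b :: real
  show "f + g + h = f + (g + h)"
    by transfer (auto simp: L32_rel_def add.assoc intro!: Lp_add_mem)
  show "f + g = g + f"
    by transfer (auto simp: L32_rel_def add.commute intro!: Lp_add_mem)
  show "0 + f = f"
    by transfer (auto simp: L32_rel_def)
  show "- f + f = 0"
    unfolding uminus_L32_def by transfer (auto simp: L32_rel_def Lp_fun_UNIV)
  show "f - g = f + - g" by (rule minus_L32_def)
  show "a *\<^sub>R (f + g) = a *\<^sub>R f + a *\<^sub>R g"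
    by transfer (auto simp: L32_rel_def distrib_left
        intro!: Lp_add_mem Lp_mult(1))
  show "(a + b) *\<^sub>R f = a *\<^sub>R f + b *\<^sub>R f"
    by transfer (auto simp: L32_rel_def distrib_right
        intro!: Lp_add_mem Lp_mult(1))
  show "a *\<^sub>R b *\<^sub>R f = (a * b) *\<^sub>R f"
    by transfer (auto simp: L32_rel_def mult.assoc intro!: Lp_mult(1))
  show "1 *\<^sub>R f = f"
    by transfer (auto simp: L32_rel_def)
  show "norm f = 0 \<longleftrightarrow> f = 0"
    by transfer (auto simp: L32_rel_def Lp_norm_eq_0 Lp_fun_UNIV)
  show "norm (f + g) \<le> norm f + norm g"
    by transfer (auto simp: L32_rel_def intro: Lp_norm_triangle)
  show "norm (a *\<^sub>R f) = \<bar>a\<bar> * norm f"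
    by transfer (auto simp: L32_rel_def Lp_mult(2))
qed (simp_all add: dist_L32_def sgn_L32_def uniformity_L32_def open_L32_def)

end

lemma L32_of_eq_iff:
  assumes "f \<in> Lp_fun (3/2) UNIV" "g \<in> Lp_fun (3/2) UNIV"
  shows "L32_of f = L32_of g \<longleftrightarrow> (AE z in lborel. f z = g z)"
  using assms Quotient_rel[OF Quotient_L32, of f g] by (auto simp: L32_rel_def)

lemma L32_rel_rep: "L32_rel (rep_L32 f) (rep_L32 f)"
  by (rule Quotient_rep_reflp[OF Quotient_L32])

lemma rep_L32_mem: "rep_L32 f \<in> Lp_fun (3/2) UNIV"
  using L32_rel_rep[of f] by (simp add: L32_rel_def)

lemma L32_of_rep: "L32_of (rep_L32 f) = f"
  by (rule Quotient_abs_rep[OF Quotient_L32])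

lemma rep_L32_of:
  assumes "f \<in> Lp_fun (3/2) UNIV"
  shows "AE z in lborel. rep_L32 (L32_of f) z = f z"
  using L32_of_eq_iff[OF rep_L32_mem assms, of "L32_of f"] by (simp add: L32_of_rep)

lemma norm_L32_of:
  assumes "f \<in> Lp_fun (3/2) UNIV"
  shows "norm (L32_of f) = Lp_norm (3/2) UNIV f"
  using assms by (simp add: norm_L32.abs_eq L32_rel_def)

lemma L32_of_add:
  assumes "f \<in> Lp_fun (3/2) UNIV" "g \<in> Lp_fun (3/2) UNIV"
  shows "L32_of (\<lambda>z. f z + g z) = L32_of f + L32_of g"
  using assms by (simp add: plus_L32.abs_eq L32_rel_def)

lemma L32_of_scale:
  assumes "f \<in> Lp_fun (3/2) UNIV"
  shows "L32_of (\<lambda>z. c * f z) = c *\<^sub>R L32_of f"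
  using assms by (simp add: scaleR_L32.abs_eq L32_rel_def)

type_synonym space = "real ^ 3"
type_synonym spacetime = "real \<times> space"

text \<open>\<open>L\<^sup>p(I; L\<^sup>p(S))\<close> is identified with \<open>L\<^sup>p(I \<times> S)\<close> by Fubini.\<close>

definition cyl :: "space set \<Rightarrow> spacetime set" where
  "cyl S = {-1<..<0} \<times> S"

definition annulus :: "space set" where
  "annulus = ball 0 1 - ball 0 (3/4)"

text \<open>\<open>Y_prs = L\<^sup>3\<^sup>/\<^sup>2(I; L\<^sup>3\<^sup>/\<^sup>2(B_{1/2}))\<close>, realised as the subspace of those elements of
  \<open>L\<^sup>3\<^sup>/\<^sup>2(\<real> \<times> \<real>\<^sup>3)\<close> that vanish a.e. outside \<open>I \<times> B_{1/2}\<close>.\<close>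

typedef yprs = "{f :: spacetime L32. AE z in lborel. z \<notin> cyl (ball 0 (1/2)) \<longrightarrow> rep_L32 f z = 0}"
proof
  have "AE z in lborel. rep_L32 (0 :: spacetime L32) z = 0"
    unfolding zero_L32.abs_eq by (rule rep_L32_of) (simp add: Lp_fun_UNIV)
  then show "0 \<in> {f :: spacetime L32. AE z in lborel. z \<notin> cyl (ball 0 (1/2)) \<longrightarrow> rep_L32 f z = 0}"
    by (auto elim: eventually_mono)
qed

setup_lifting type_definition_yprs

lemma rep_L32_add: "AE z in lborel. rep_L32 (f + g) z = rep_L32 f z + rep_L32 g z"
  using rep_L32_of[OF Lp_add_mem[OF _ rep_L32_mem rep_L32_mem], of f g]
  by (simp add: L32_of_add rep_L32_mem L32_of_rep)

lemma rep_L32_scale: "AE z in lborel. rep_L32 (c *\<^sub>R f) z = c * rep_L32 f z"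
  using rep_L32_of[OF Lp_mult(1)[OF _ rep_L32_mem], of c f]
  by (simp add: L32_of_scale rep_L32_mem L32_of_rep)

instantiation yprs :: real_normed_vector
begin

lift_definition zero_yprs :: yprs is 0
proof -
  have "AE z in lborel. rep_L32 (0 :: spacetime L32) z = 0"
    unfolding zero_L32.abs_eq by (rule rep_L32_of) (simp add: Lp_fun_UNIV)
  then show "AE z in lborel. z \<notin> cyl (ball 0 (1/2)) \<longrightarrow> rep_L32 0 z = 0"
    by (auto elim: eventually_mono)
qed

lift_definition plus_yprs :: "yprs \<Rightarrow> yprs \<Rightarrow> yprs" is "(+)"
proof -
  fix f g :: "spacetime L32"
  assume "AE z in lborel. z \<notin> cyl (ball 0 (1/2)) \<longrightarrow> rep_L32 f z = 0"
    and "AE z in lborel. z \<notin> cyl (ball 0 (1/2)) \<longrightarrow> rep_L32 g z = 0"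
  then show "AE z in lborel. z \<notin> cyl (ball 0 (1/2)) \<longrightarrow> rep_L32 (f + g) z = 0"
    using rep_L32_add[of f g] by eventually_elim auto
qed

lift_definition scaleR_yprs :: "real \<Rightarrow> yprs \<Rightarrow> yprs" is "(*\<^sub>R)"
proof -
  fix c and f :: "spacetime L32"
  assume "AE z in lborel. z \<notin> cyl (ball 0 (1/2)) \<longrightarrow> rep_L32 f z = 0"
  then show "AE z in lborel. z \<notin> cyl (ball 0 (1/2)) \<longrightarrow> rep_L32 (c *\<^sub>R f) z = 0"
    using rep_L32_scale[of c f] by eventually_elim auto
qed

definition "uminus_yprs (f :: yprs) = (-1) *\<^sub>R f"
definition "minus_yprs (f :: yprs) g = f + - g"

lift_definition norm_yprs :: "yprs \<Rightarrow> real" is norm .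

definition "dist_yprs (f :: yprs) g = norm (f - g)"
definition "sgn_yprs (f :: yprs) = inverse (norm f) *\<^sub>R f"
definition "uniformity_yprs = (INF e\<in>{0<..}. principal {(x, y :: yprs). dist x y < e})"
definition "open_yprs (U :: yprs set) \<longleftrightarrow> (\<forall>x\<in>U. \<forall>\<^sub>F (x', y) in uniformity. x' = x \<longrightarrow> y \<in> U)"

instance
proof
  fix f g h :: yprs and a b :: real
  show "f + g + h = f + (g + h)" by transfer (simp add: add.assoc)
  show "f + g = g + f" by transfer (simp add: add.commute)
  show "0 + f = f" by transfer simp
  show "- f + f = 0" unfolding uminus_yprs_def by transfer simp
  show "f - g = f + - g" by (rule minus_yprs_def)
  show "a *\<^sub>R (f + g) = a *\<^sub>R f + a *\<^sub>R g" by transfer (rule scaleR_add_right)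
  show "(a + b) *\<^sub>R f = a *\<^sub>R f + b *\<^sub>R f" by transfer (rule scaleR_add_left)
  show "a *\<^sub>R b *\<^sub>R f = (a * b) *\<^sub>R f" by transfer simp
  show "1 *\<^sub>R f = f" by transfer simp
  show "norm f = 0 \<longleftrightarrow> f = 0" by transfer simp
  show "norm (f + g) \<le> norm f + norm g" by transfer (rule norm_triangle_ineq)
  show "norm (a *\<^sub>R f) = \<bar>a\<bar> * norm f" by transfer simp
qed (simp_all add: dist_yprs_def sgn_yprs_def uniformity_yprs_def open_yprs_def)

end

lift_definition restrict_yprs :: "spacetime L32 \<Rightarrow> yprs" is
  "\<lambda>f. L32_of (\<lambda>z. indicator (cyl (ball 0 (1/2))) z * rep_L32 f z)"
proof -
  fix f :: "spacetime L32"
  let ?C = "cyl (ball 0 (1/2)) :: spacetime set"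
  have C: "?C \<in> sets borel"
    unfolding cyl_def by (intro borel_open open_Times) auto
  have "(\<lambda>z. indicator ?C z * rep_L32 f z) \<in> Lp_fun (3/2) UNIV"
    unfolding Lp_fun_UNIV
  proof
    show m: "(\<lambda>z. indicator ?C z * rep_L32 f z) \<in> borel_measurable lborel"
      using rep_L32_mem[of f] C by (auto simp: Lp_fun_UNIV)
    show "integrable lborel (\<lambda>z. norm (indicator ?C z * rep_L32 f z) powr (3/2))"
    proof (rule Bochner_Integration.integrable_bound)
      show "integrable lborel (\<lambda>z. norm (rep_L32 f z) powr (3/2))"
        using rep_L32_mem[of f] by (simp add: Lp_fun_UNIV)
      show "(\<lambda>z. norm (indicator ?C z * rep_L32 f z) powr (3/2)) \<in> borel_measurable lborel"
        using m by auto
    qed (auto simp: indicator_def)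
  qed
  from rep_L32_of[OF this]
  show "AE z in lborel. z \<notin> ?C \<longrightarrow> rep_L32 (L32_of (\<lambda>z. indicator ?C z * rep_L32 f z)) z = 0"
    by eventually_elim auto
qed

fun Ck :: "nat \<Rightarrow> (space \<Rightarrow> real) \<Rightarrow> bool" where
  "Ck 0 f \<longleftrightarrow> continuous_on UNIV f"
| "Ck (Suc n) f \<longleftrightarrow> f differentiable_on UNIV \<and>
     (\<forall>i. Ck n (\<lambda>x. frechet_derivative f (at x) (axis i 1)))"

definition Cc_infinity :: "space set \<Rightarrow> (space \<Rightarrow> real) set" where
  "Cc_infinity S = {f. (\<forall>n. Ck n f) \<and> compact (closure {x. f x \<noteq> 0}) \<and> closure {x. f x \<noteq> 0} \<subseteq> S}"

text \<open>The principal value integral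
  \<open>c_3 p.v.\<integral> y_j / |y|\<^sup>4 \<phi>(x - y) dy\<close> with \<open>c_3 = \<Gamma>(2) / \<pi>\<^sup>2 = 1 / \<pi>\<^sup>2\<close>.\<close>

definition riesz_pv :: "3 \<Rightarrow> (space \<Rightarrow> real) \<Rightarrow> space \<Rightarrow> real" where
  "riesz_pv j \<phi> x = 1 / pi\<^sup>2 *
     Lim (at_right 0) (\<lambda>\<epsilon>. LINT y:{y. \<epsilon> < norm y}|lborel. y $ j / norm y ^ 4 * \<phi> (x - y))"

text \<open>The Riesz transform on \<open>L\<^sup>3\<^sup>/\<^sup>2(\<real>\<^sup>3)\<close> is the bounded linear extension of the singular
  integral from test functions. It exists by the Calderon-Zygmund theorem and is unique because
  test functions are dense.\<close>

definition riesz :: "3 \<Rightarrow> space L32 \<Rightarrow>\<^sub>L space L32" where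
  "riesz j = (THE T. \<forall>\<phi>\<in>Cc_infinity UNIV. blinfun_apply T (L32_of \<phi>) = L32_of (riesz_pv j \<phi>))"

definition time_slice :: "spacetime L32 \<Rightarrow> real \<Rightarrow> space L32" where
  "time_slice f t = L32_of (\<lambda>x. rep_L32 f (t, x))"

text \<open>The Riesz transform acting in space at almost every time. Almost every slice of a function
  in \<open>L\<^sup>3\<^sup>/\<^sup>2(\<real> \<times> \<real>\<^sup>3)\<close> lies in \<open>L\<^sup>3\<^sup>/\<^sup>2(\<real>\<^sup>3)\<close> and its class does not depend on the representative, so
  the operator is determined by its slices; it exists since a bounded operator on
  \<open>L\<^sup>3\<^sup>/\<^sup>2(\<real>\<^sup>3)\<close> acts boundedly on \<open>L\<^sup>3\<^sup>/\<^sup>2(\<real>; L\<^sup>3\<^sup>/\<^sup>2(\<real>\<^sup>3))\<close>. Functions on the time interval \<open>I\<close>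
  are extended by zero to all times.\<close>

definition riesz_st :: "3 \<Rightarrow> spacetime L32 \<Rightarrow>\<^sub>L spacetime L32" where
  "riesz_st j = (THE T. \<forall>f. AE t in lborel.
     time_slice (blinfun_apply T f) t = blinfun_apply (riesz j) (time_slice f t))"

text \<open>\<open>R_i R_j (M_ij)\<close>, summed over \<open>i\<close> and \<open>j\<close>, for a tensor \<open>M\<close> on \<open>I \<times> B_1\<close> extended by zero.\<close>

definition RR :: "(spacetime \<Rightarrow> real ^ 3 ^ 3) \<Rightarrow> spacetime L32" where
  "RR M = (\<Sum>i\<in>UNIV. \<Sum>j\<in>UNIV. blinfun_apply (riesz_st i) (blinfun_apply (riesz_st j)
     (L32_of (\<lambda>z. indicator (cyl (ball 0 1)) z * M z $ i $ j))))"

definition cutoff_mult :: "(space \<Rightarrow> real) \<Rightarrow> spacetime L32 \<Rightarrow> spacetime L32" where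
  "cutoff_mult \<eta> f = L32_of (\<lambda>z. \<eta> (snd z) * rep_L32 f z)"

definition outer :: "(spacetime \<Rightarrow> real ^ 3) \<Rightarrow> spacetime \<Rightarrow> real ^ 3 ^ 3" where
  "outer v z = (\<chi> i j. v z $ i * v z $ j)"

definition cutoff_tensor :: "(space \<Rightarrow> real) \<Rightarrow> (spacetime \<Rightarrow> real ^ 3 ^ 3) \<Rightarrow> spacetime \<Rightarrow> real ^ 3 ^ 3" where
  "cutoff_tensor \<eta> M z = \<eta> (snd z) *\<^sub>R M z"

text \<open>A package is a family of vectors indexed by \<open>k\<close> and \<open>j\<close>. The normed spaces \<open>X_k^(j)\<close> are subspaces
  of one ambient normed space, which is no restriction: finitely many normed spaces embed
  isometrically in their product. Outside the index set a package is zero by convention.\<close>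

type_synonym 'v pkg = "int \<Rightarrow> nat \<Rightarrow> 'v"

definition packages :: "int set \<Rightarrow> (int \<Rightarrow> nat \<Rightarrow> 'v::real_normed_vector set) \<Rightarrow> 'v pkg set" where
  "packages \<Lambda> X = {D. (\<forall>k\<in>\<Lambda>. \<forall>j\<in>{1..7}. D k j \<in> X k j) \<and>
     (\<forall>k j. k \<notin> \<Lambda> \<or> j \<notin> {1..7} \<longrightarrow> D k j = 0)}"

definition pkg_comb :: "real \<Rightarrow> 'v::real_normed_vector pkg \<Rightarrow> real \<Rightarrow> 'v pkg \<Rightarrow> 'v pkg" where
  "pkg_comb a D b E = (\<lambda>k j. a *\<^sub>R D k j + b *\<^sub>R E k j)"

definition pkg_diff :: "'v::real_normed_vector pkg \<Rightarrow> 'v pkg \<Rightarrow> 'v pkg" where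
  "pkg_diff D E = (\<lambda>k j. D k j - E k j)"

definition pkg_subspace :: "'v::real_normed_vector pkg set \<Rightarrow> 'v pkg set \<Rightarrow> bool" where
  "pkg_subspace V \<Gamma> \<longleftrightarrow> \<Gamma> \<subseteq> V \<and> (\<lambda>k j. 0) \<in> \<Gamma> \<and>
     (\<forall>D\<in>\<Gamma>. \<forall>E\<in>\<Gamma>. \<forall>a b. pkg_comb a D b E \<in> \<Gamma>)"

definition norm_loc :: "int set \<Rightarrow> (nat \<Rightarrow> real) \<Rightarrow> 'v::real_normed_vector pkg \<Rightarrow> real" where
  "norm_loc \<Lambda> a D = sqrt (\<Sum>k\<in>\<Lambda>. \<Sum>j\<in>{1..7}. a j * (norm (D k j))\<^sup>2)"

definition F_cl :: "('d \<Rightarrow> spacetime \<Rightarrow> real ^ 3) \<Rightarrow> ('d \<Rightarrow> spacetime \<Rightarrow> real ^ 3 ^ 3) \<Rightarrow>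
    'd \<Rightarrow> spacetime \<Rightarrow> real ^ 3 ^ 3" where
  "F_cl U R D z = outer (U D) z + R D z"

definition M_act :: "(space \<Rightarrow> real) \<Rightarrow> ('d \<Rightarrow> spacetime \<Rightarrow> real ^ 3) \<Rightarrow> ('d \<Rightarrow> spacetime \<Rightarrow> real ^ 3) \<Rightarrow>
    ('d \<Rightarrow> spacetime \<Rightarrow> real ^ 3 ^ 3) \<Rightarrow> 'd \<Rightarrow> spacetime \<Rightarrow> real ^ 3 ^ 3" where
  "M_act \<eta> u U R D z = cutoff_tensor \<eta> (outer (u D)) z - F_cl U R D z"

definition P_src :: "(space \<Rightarrow> real) \<Rightarrow> ('d \<Rightarrow> spacetime \<Rightarrow> real ^ 3) \<Rightarrow> ('d \<Rightarrow> spacetime \<Rightarrow> real ^ 3) \<Rightarrow>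
    ('d \<Rightarrow> spacetime \<Rightarrow> real ^ 3 ^ 3) \<Rightarrow> ('d \<Rightarrow> 'h::real_normed_vector) \<Rightarrow>
    (yprs \<Rightarrow>\<^sub>L yprs) \<Rightarrow> ('h \<Rightarrow>\<^sub>L 'h) \<Rightarrow> ('h \<Rightarrow>\<^sub>L yprs) \<Rightarrow> 'd \<Rightarrow> yprs" where
  "P_src \<eta> u U R p_harm P Pi_harm J D =
     restrict_yprs (RR (cutoff_tensor \<eta> (outer (u D))))
     - blinfun_apply P (restrict_yprs (RR (F_cl U R D)))
     - blinfun_apply J (p_harm D - blinfun_apply Pi_harm (p_harm D))"

definition Err_src :: "'v::real_normed_vector pkg set \<Rightarrow> (space \<Rightarrow> real) \<Rightarrow> ('v pkg \<Rightarrow> spacetime \<Rightarrow> real ^ 3) \<Rightarrow>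
    ('v pkg \<Rightarrow> spacetime \<Rightarrow> real ^ 3) \<Rightarrow> ('v pkg \<Rightarrow> spacetime \<Rightarrow> real ^ 3 ^ 3) \<Rightarrow>
    ('v pkg \<Rightarrow> 'h::real_normed_vector) \<Rightarrow>
    (yprs \<Rightarrow>\<^sub>L yprs) \<Rightarrow> ('h \<Rightarrow>\<^sub>L 'h) \<Rightarrow> ('h \<Rightarrow>\<^sub>L yprs) \<Rightarrow> 'v pkg \<Rightarrow> real" where
  "Err_src \<Gamma> \<eta> u U R p_harm P Pi_harm J D =
     (INF \<zeta>\<in>\<Gamma>. norm (P_src \<eta> u U R p_harm P Pi_harm J (pkg_diff D \<zeta>)))"

definition T_proj :: "('v::real_normed_vector pkg \<Rightarrow> spacetime \<Rightarrow> real ^ 3) \<Rightarrow>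
    ('v pkg \<Rightarrow> spacetime \<Rightarrow> real ^ 3 ^ 3) \<Rightarrow> (yprs \<Rightarrow>\<^sub>L yprs) \<Rightarrow> 'v pkg \<Rightarrow> 'v pkg \<Rightarrow> real" where
  "T_proj U R P D \<zeta> = (1 + norm P) * norm (restrict_yprs (RR (F_cl U R (pkg_diff D \<zeta>))))"

definition T_harm :: "('v::real_normed_vector pkg \<Rightarrow> 'h::real_normed_vector) \<Rightarrow>
    ('h \<Rightarrow>\<^sub>L 'h) \<Rightarrow> ('h \<Rightarrow>\<^sub>L yprs) \<Rightarrow> 'v pkg \<Rightarrow> 'v pkg \<Rightarrow> real" where
  "T_harm p_harm Pi_harm J D \<zeta> =
     norm J * norm (p_harm (pkg_diff D \<zeta>) - blinfun_apply Pi_harm (p_harm (pkg_diff D \<zeta>)))"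

definition tail_cost :: "int set \<Rightarrow> (nat \<Rightarrow> real) \<Rightarrow> real \<Rightarrow> real \<Rightarrow>
    ('v::real_normed_vector pkg \<Rightarrow> spacetime \<Rightarrow> real ^ 3) \<Rightarrow> ('v pkg \<Rightarrow> spacetime \<Rightarrow> real ^ 3 ^ 3) \<Rightarrow>
    ('v pkg \<Rightarrow> 'h::real_normed_vector) \<Rightarrow>
    (yprs \<Rightarrow>\<^sub>L yprs) \<Rightarrow> ('h \<Rightarrow>\<^sub>L 'h) \<Rightarrow> ('h \<Rightarrow>\<^sub>L yprs) \<Rightarrow> 'v pkg \<Rightarrow> 'v pkg \<Rightarrow> real" where
  "tail_cost \<Lambda> a \<alpha>_proj \<alpha>_harm U R p_harm P Pi_harm J D \<zeta> =
     norm_loc \<Lambda> a (pkg_diff D \<zeta>) + \<alpha>_proj * T_proj U R P D \<zeta> + \<alpha>_harm * T_harm p_harm Pi_harm J D \<zeta>"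

definition dist_tail :: "int set \<Rightarrow> (nat \<Rightarrow> real) \<Rightarrow> 'v::real_normed_vector pkg set \<Rightarrow> real \<Rightarrow> real \<Rightarrow>
    ('v pkg \<Rightarrow> spacetime \<Rightarrow> real ^ 3) \<Rightarrow> ('v pkg \<Rightarrow> spacetime \<Rightarrow> real ^ 3 ^ 3) \<Rightarrow>
    ('v pkg \<Rightarrow> 'h::real_normed_vector) \<Rightarrow>
    (yprs \<Rightarrow>\<^sub>L yprs) \<Rightarrow> ('h \<Rightarrow>\<^sub>L 'h) \<Rightarrow> ('h \<Rightarrow>\<^sub>L yprs) \<Rightarrow> 'v pkg \<Rightarrow> real" where
  "dist_tail \<Lambda> a \<Gamma> \<alpha>_proj \<alpha>_harm U R p_harm P Pi_harm J D =
     (INF \<zeta>\<in>\<Gamma>. tail_cost \<Lambda> a \<alpha>_proj \<alpha>_harm U R p_harm P Pi_harm J D \<zeta>)"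

end

theory Submission
  imports Defs
begin

text \<open>Evaluate the infimum at the hypothesised corrector \<open>\<zeta>\<close>. Since \<open>\<eta> f = M_act + F_cl\<close>, linearity
  of the Riesz transforms splits the mismatch at \<open>D - \<zeta>\<close> into the active part \<open>R_i R_j (M_act)\<close>, the
  projection defect \<open>(1 - P) R_i R_j (F_cl)\<close> and the harmonic tail. The first is controlled by the
  core hypothesis (the annular term there is nonnegative), the other two by the tails, whose weighted
  sum is part of \<open>dist_tail\<close>.\<close>

section \<open>Integrability on a set, reduced to the whole space\<close>

text \<open>Extension by zero commutes with \<open>norm _ powr p\<close> because
  \<open>0 powr p = 0\<close> for every \<open>p\<close>. This lets the closure properties known on
  \<open>UNIV\<close> be used on \<open>S\<close>.\<close>

lemma Lp_fun_indicator:
  "f \<in> Lp_fun p S \<longleftrightarrow> (\<lambda>z. indicator S z *\<^sub>R f z) \<in> Lp_fun p UNIV"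
proof -
  have "(\<lambda>z. norm (indicator S z *\<^sub>R f z) powr p) = (\<lambda>z. indicator S z *\<^sub>R norm (f z) powr p)"
    by (auto simp: indicator_def)
  then show ?thesis
    by (simp add: Lp_fun_def set_borel_measurable_def set_integrable_def)
qed

lemma Lp_fun_dominated:
  assumes g: "g \<in> Lp_fun p UNIV" and f: "f \<in> borel_measurable lborel"
    and p: "1 \<le> p" and le: "\<And>z. norm (f z) \<le> C * norm (g z)"
  shows "f \<in> Lp_fun p UNIV"
  unfolding Lp_fun_UNIV
proof
  show "integrable lborel (\<lambda>z. norm (f z) powr p)"
  proof (rule Bochner_Integration.integrable_bound)
    show "integrable lborel (\<lambda>z. norm (C *\<^sub>R g z) powr p)"
      using Lp_scale(1)[OF p g, of C] by (simp add: Lp_fun_UNIV)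
    show "(\<lambda>z. norm (f z) powr p) \<in> borel_measurable lborel"
      using f by measurable
    \<comment> \<open>The sign of \<open>C\<close> is left open, so the comparison goes through
      \<open>\<bar>C\<bar>\<close>.\<close>
    have "norm (f z) \<le> norm (C *\<^sub>R g z)" for z
      using le[of z] mult_right_mono[OF abs_ge_self[of C] norm_ge_zero[of "g z"]] by simp
    then show "AE z in lborel. norm (norm (f z) powr p) \<le> norm (norm (C *\<^sub>R g z) powr p)"
      using p by (intro AE_I2) (simp add: powr_mono2)
  qed
qed (rule f)

lemma Lp_fun_diff:
  assumes "1 \<le> p" "f \<in> Lp_fun p S" "g \<in> Lp_fun p S"
  shows "(\<lambda>z. f z - g z) \<in> Lp_fun p S"
  using Lp_add_mem[OF assms(1), of "\<lambda>z. indicator S z *\<^sub>R f z" "\<lambda>z. (-1) *\<^sub>R (indicator S z *\<^sub>R g z)"]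
    Lp_scale(1)[OF assms(1), of "\<lambda>z. indicator S z *\<^sub>R g z" "-1"] assms(2,3)
  by (simp add: Lp_fun_indicator[of _ _ S] scaleR_diff_right)

text \<open>An entry is at most the Frobenius norm. The conclusion has exactly the form of the
  functions that \<open>RR\<close> passes to \<open>L32_of\<close>.\<close>

lemma Lp_fun_entry:
  fixes M :: "'a::euclidean_space \<Rightarrow> real ^ 'm ^ 'n"
  assumes p: "1 \<le> p" and M: "M \<in> Lp_fun p S"
  shows "(\<lambda>z. indicator S z * M z $ i $ j) \<in> Lp_fun p UNIV"
proof (rule Lp_fun_dominated[OF _ _ p])
  show "(\<lambda>z. indicator S z *\<^sub>R M z) \<in> Lp_fun p UNIV"
    using M by (simp add: Lp_fun_indicator[of _ _ S])
  then have "(\<lambda>z. indicator S z *\<^sub>R M z) \<in> borel_measurable lborel"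
    by (simp add: Lp_fun_UNIV)
  moreover have "(\<lambda>A :: real ^ 'm ^ 'n. A $ i $ j) \<in> borel_measurable borel"
    by (intro borel_measurable_continuous_onI continuous_intros)
  ultimately have "(\<lambda>z. (indicator S z *\<^sub>R M z) $ i $ j) \<in> borel_measurable lborel"
    by (rule measurable_compose)
  then show "(\<lambda>z. indicator S z * M z $ i $ j) \<in> borel_measurable lborel"
    by simp
  show "norm (indicator S z * M z $ i $ j) \<le> 1 * norm (indicator S z *\<^sub>R M z)" for z
    using order_trans[OF component_le_norm_cart[of "M z $ i" j] Finite_Cartesian_Product.norm_nth_le[of "M z" i]]
    by (simp add: indicator_def)
qed

section \<open>Tensor products and cutoffs\<close>

text \<open>Row \<open>i\<close> of the tensor is \<open>v z $ i *\<^sub>R v z\<close>, so the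
  factor \<open>norm (v z)\<close> comes out of the Euclidean norm of the row norms.\<close>

lemma norm_outer: "norm (outer v z) = (norm (v z))\<^sup>2"
proof -
  have "outer v z = (\<chi> i. v z $ i *\<^sub>R v z)"
    by (simp add: outer_def vec_eq_iff)
  then have "norm (outer v z) = L2_set (\<lambda>i. norm (v z) * norm (v z $ i)) UNIV"
    by (simp add: norm_vec_def[of "vec_lambda _"] mult.commute)
  also have "\<dots> = norm (v z) * norm (v z)"
    by (simp add: L2_set_right_distrib[symmetric] norm_vec_def)
  finally show ?thesis by (simp add: power2_eq_square)
qed

text \<open>The exponent halves because the tensor is quadratic: by \<open>norm_outer\<close>, its
  norm to the power 3/2 is the cube of the norm of \<open>v\<close>.\<close>

lemma outer_Lp_fun:
  assumes "v \<in> Lp_fun 3 S"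
  shows "outer v \<in> Lp_fun (3/2) S"
proof -
  \<comment> \<open>Only the zero extension of \<open>v\<close> is known to be measurable. Cutting
    off before or after taking \<open>outer\<close> gives the same tensor, since an indicator equals
    its square.\<close>
  define w where "w = (\<lambda>z. indicator S z *\<^sub>R v z)"
  have w: "w \<in> Lp_fun 3 UNIV"
    using assms by (simp add: w_def Lp_fun_indicator[of _ _ S])
  have "(\<lambda>y :: real ^ 3. (\<chi> i j. y $ i * y $ j) :: real ^ 3 ^ 3) \<in> borel_measurable borel"
    by (intro borel_measurable_continuous_onI continuous_intros)
  from measurable_compose[OF _ this, of w lborel] w
  have m: "outer w \<in> borel_measurable lborel"
    by (simp add: Lp_fun_UNIV outer_def[abs_def])
  have "norm (outer w z) powr (3/2) = norm (w z) powr 3" for z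
    by (cases "w z = 0") (simp_all add: norm_outer powr_powr flip: powr_numeral)
  then have "outer w \<in> Lp_fun (3/2) UNIV"
    using w m by (simp add: Lp_fun_UNIV)
  moreover have "outer w = (\<lambda>z. indicator S z *\<^sub>R outer v z)"
    by (auto simp: fun_eq_iff outer_def w_def vec_eq_iff indicator_def)
  ultimately show ?thesis by (simp add: Lp_fun_indicator[of _ _ S])
qed

lemma Cc_infinity_continuous: "\<eta> \<in> Cc_infinity S \<Longrightarrow> continuous_on UNIV \<eta>"
  unfolding Cc_infinity_def by (metis (mono_tags, lifting) Ck.simps(1) mem_Collect_eq)

lemma Cc_infinity_bounded:
  assumes "\<eta> \<in> Cc_infinity S"
  obtains C where "\<And>x. \<bar>\<eta> x\<bar> \<le> C"
proof -
  let ?K = "closure {x. \<eta> x \<noteq> 0}"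
  have "compact ?K" using assms by (simp add: Cc_infinity_def)
  then have "compact (\<eta> ` ?K)"
    by (intro compact_continuous_image continuous_on_subset[OF Cc_infinity_continuous[OF assms]]) auto
  then obtain C where C: "0 < C" "\<And>x. x \<in> ?K \<Longrightarrow> \<bar>\<eta> x\<bar> \<le> C"
    using compact_imp_bounded bounded_pos by (metis image_eqI real_norm_def)
  \<comment> \<open>Positivity of \<open>C\<close> covers the points where \<open>\<eta>\<close>
    vanishes.\<close>
  have "\<bar>\<eta> x\<bar> \<le> C" for x
    using C closure_subset[of "{x. \<eta> x \<noteq> 0}"] by (cases "\<eta> x = 0") auto
  then show ?thesis by (rule that)
qed

lemma cutoff_tensor_Lp_fun:
  assumes \<eta>: "\<eta> \<in> Cc_infinity T" and p: "1 \<le> p" and M: "M \<in> Lp_fun p S"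
  shows "cutoff_tensor \<eta> M \<in> Lp_fun p S"
proof -
  obtain C where C: "\<And>x. \<bar>\<eta> x\<bar> \<le> C" using Cc_infinity_bounded[OF \<eta>] by blast
  let ?N = "\<lambda>z. indicator S z *\<^sub>R M z"
  have N: "?N \<in> Lp_fun p UNIV" using M by (simp add: Lp_fun_indicator[of _ _ S])
  have "(\<lambda>z :: spacetime. \<eta> (snd z)) \<in> borel_measurable lborel"
    unfolding measurable_lborel2
    by (intro borel_measurable_continuous_onI continuous_on_compose2[OF Cc_infinity_continuous[OF \<eta>]]
        continuous_intros) auto
  moreover have "?N \<in> borel_measurable lborel"
    using N by (simp add: Lp_fun_UNIV)
  ultimately have "(\<lambda>z. \<eta> (snd z) *\<^sub>R ?N z) \<in> borel_measurable lborel"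
    by (rule borel_measurable_scaleR)
  moreover have "norm (\<eta> (snd z) *\<^sub>R ?N z) \<le> C * norm (?N z)" for z
    unfolding norm_scaleR[of "\<eta> (snd z)"] by (rule mult_right_mono[OF C norm_ge_zero])
  ultimately have "(\<lambda>z. \<eta> (snd z) *\<^sub>R ?N z) \<in> Lp_fun p UNIV"
    by (intro Lp_fun_dominated[OF N _ p]) auto
  moreover have "(\<lambda>z. \<eta> (snd z) *\<^sub>R ?N z) = (\<lambda>z. indicator S z *\<^sub>R cutoff_tensor \<eta> M z)"
    by (simp add: cutoff_tensor_def mult.commute)
  ultimately show ?thesis by (simp add: Lp_fun_indicator[of _ _ S])
qed

section \<open>Additivity of the pressure operators\<close>

text \<open>Integrability makes \<open>L32_of\<close> additive on the entries; the Riesz operators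
  are linear by their type.\<close>

lemma RR_add:
  assumes "M \<in> Lp_fun (3/2) (cyl (ball 0 1))" "N \<in> Lp_fun (3/2) (cyl (ball 0 1))"
  shows "RR (\<lambda>z. M z + N z) = RR M + RR N"
  using Lp_fun_entry[OF _ assms(1)] Lp_fun_entry[OF _ assms(2)]
  by (simp add: RR_def distrib_left L32_of_add blinfun.add_right sum.distrib)

lemma indicator_rep_L32_mem:
  assumes "S \<in> sets borel"
  shows "(\<lambda>z. indicator S z * rep_L32 f z) \<in> Lp_fun (3/2) UNIV"
proof (rule Lp_fun_dominated[OF rep_L32_mem[of f]])
  show "(\<lambda>z. indicator S z * rep_L32 f z) \<in> borel_measurable lborel"
    using assms rep_L32_mem[of f] by (auto simp: Lp_fun_UNIV)
  show "norm (indicator S z * rep_L32 f z) \<le> 1 * norm (rep_L32 f z)" for z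
    by (simp add: indicator_def)
qed simp

text \<open>Representatives chosen by \<open>rep_L32\<close> add up only almost everywhere, which
  suffices for equality of classes.\<close>

lemma restrict_yprs_add: "restrict_yprs (f + g) = restrict_yprs f + restrict_yprs g"
proof transfer
  fix f g :: "spacetime L32"
  let ?C = "cyl (ball 0 (1/2)) :: spacetime set"
  have C: "?C \<in> sets borel"
    unfolding cyl_def by (intro borel_open open_Times) auto
  note mem = indicator_rep_L32_mem[OF C]
  have "L32_of (\<lambda>z. indicator ?C z * rep_L32 (f + g) z) =
      L32_of (\<lambda>z. indicator ?C z * rep_L32 f z + indicator ?C z * rep_L32 g z)"
    by (subst L32_of_eq_iff[OF mem Lp_add_mem[OF _ mem mem]])
      (use rep_L32_add[of f g] in \<open>auto simp: distrib_left elim: eventually_mono\<close>)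
  then show "L32_of (\<lambda>z. indicator ?C z * rep_L32 (f + g) z) =
      L32_of (\<lambda>z. indicator ?C z * rep_L32 f z) + L32_of (\<lambda>z. indicator ?C z * rep_L32 g z)"
    by (simp add: L32_of_add mem)
qed

lemma pkg_diff_packages:
  assumes "\<And>k j. k \<in> \<Lambda> \<Longrightarrow> j \<in> {1..7} \<Longrightarrow> subspace (X k j)"
    and "D \<in> packages \<Lambda> X" "E \<in> packages \<Lambda> X"
  shows "pkg_diff D E \<in> packages \<Lambda> X"
  using assms by (auto simp: packages_def pkg_diff_def intro: subspace_diff)

section \<open>The mismatch bound and its evaluation at the corrector\<close>

lemma M_act_Lp_fun:
  assumes "\<eta> \<in> Cc_infinity T" "u D \<in> Lp_fun 3 S" "F_cl U R D \<in> Lp_fun (3/2) S"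
  shows "M_act \<eta> u U R D \<in> Lp_fun (3/2) S"
  unfolding M_act_def[abs_def]
  using assms by (intro Lp_fun_diff cutoff_tensor_Lp_fun outer_Lp_fun) simp_all

text \<open>At \<open>pkg_diff D \<zeta>\<close> the last two summands are exactly
  \<open>T_proj\<close> and \<open>T_harm\<close>. The factor \<open>1 + norm P\<close> comes from
  the triangle inequality for the projection defect.\<close>

lemma norm_P_src_le:
  assumes \<eta>: "\<eta> \<in> Cc_infinity T"
    and u: "u D \<in> Lp_fun 3 (cyl (ball 0 1))"
    and F: "F_cl U R D \<in> Lp_fun (3/2) (cyl (ball 0 1))"
  shows "norm (P_src \<eta> u U R p_harm P Pi_harm J D) \<le>
    norm (restrict_yprs (RR (M_act \<eta> u U R D)))
    + (1 + norm P) * norm (restrict_yprs (RR (F_cl U R D)))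
    + norm J * norm (p_harm D - blinfun_apply Pi_harm (p_harm D))"
proof -
  note M = M_act_Lp_fun[where u=u, OF \<eta> u F]
  let ?m = "restrict_yprs (RR (M_act \<eta> u U R D))"
  let ?f = "restrict_yprs (RR (F_cl U R D))"
  let ?q = "p_harm D - blinfun_apply Pi_harm (p_harm D)"
  have "cutoff_tensor \<eta> (outer (u D)) = (\<lambda>z. M_act \<eta> u U R D z + F_cl U R D z)"
    by (simp add: M_act_def)
  then have "P_src \<eta> u U R p_harm P Pi_harm J D = ?m + (?f - blinfun_apply P ?f) - blinfun_apply J ?q"
    by (simp add: P_src_def RR_add[OF M F] restrict_yprs_add)
  also have "norm \<dots> \<le> norm ?m + (norm ?f + norm (blinfun_apply P ?f)) + norm (blinfun_apply J ?q)"
    by (intro order_trans[OF norm_triangle_ineq4] order_trans[OF norm_triangle_ineq]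
        add_mono norm_triangle_ineq4 order_refl)
  also have "\<dots> \<le> norm ?m + (norm ?f + norm P * norm ?f) + norm J * norm ?q"
    by (intro add_mono norm_blinfun order_refl)
  finally show "norm (P_src \<eta> u U R p_harm P Pi_harm J D) \<le> norm ?m + (1 + norm P) * norm ?f + norm J * norm ?q"
    by (simp add: distrib_right)
qed

text \<open>Write \<open>x\<close> as \<open>inverse \<alpha> * (\<alpha> * x)\<close>, likewise
  \<open>y\<close>, and enlarge both factors to the maximum. The extra \<open>s\<close> only
  increases the right side; it will be the package norm.\<close>

lemma add_le_max_inverse_mult:
  fixes \<alpha> \<beta> :: real
  assumes "0 < \<alpha>" "0 < \<beta>" "0 \<le> s" "0 \<le> x" "0 \<le> y"
  shows "x + y \<le> max (inverse \<alpha>) (inverse \<beta>) * (s + \<alpha> * x + \<beta> * y)"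
proof -
  let ?m = "max (inverse \<alpha>) (inverse \<beta>)"
  have "inverse \<alpha> * (\<alpha> * x) \<le> ?m * (\<alpha> * x)" "inverse \<beta> * (\<beta> * y) \<le> ?m * (\<beta> * y)"
    using assms by (intro mult_right_mono; simp)+
  then have "x \<le> ?m * (\<alpha> * x)" "y \<le> ?m * (\<beta> * y)"
    using assms(1,2) by (simp_all flip: mult.assoc)
  moreover have "0 \<le> ?m * s"
    using assms by (intro mult_nonneg_nonneg) (simp_all add: le_max_iff_disj)
  ultimately show ?thesis
    by (simp only: distrib_left)
qed

theorem theorem9p89:
  fixes \<Lambda> :: "int set"
    and X :: "int \<Rightarrow> nat \<Rightarrow> 'v::real_normed_vector set"
    and a :: "nat \<Rightarrow> real"
    and \<Gamma> :: "'v pkg set"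
    and \<eta> :: "space \<Rightarrow> real"
    and u U :: "'v pkg \<Rightarrow> spacetime \<Rightarrow> real ^ 3"
    and R :: "'v pkg \<Rightarrow> spacetime \<Rightarrow> real ^ 3 ^ 3"
    and p_harm :: "'v pkg \<Rightarrow> 'h::real_normed_vector"
    and P :: "yprs \<Rightarrow>\<^sub>L yprs"
    and Pi_harm :: "'h \<Rightarrow>\<^sub>L 'h"
    and J :: "'h \<Rightarrow>\<^sub>L yprs"
    and C_\<eta> C_Riesz \<alpha>_proj \<alpha>_harm \<eta>_core \<Delta>_core :: real
  assumes "\<exists>m n. \<Lambda> = {m..n}"
    and "\<And>k j. k \<in> \<Lambda> \<Longrightarrow> j \<in> {1..7} \<Longrightarrow> subspace (X k j)"
    and "\<And>j. j \<in> {1..7} \<Longrightarrow> 0 < a j"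
    and "pkg_subspace (packages \<Lambda> X) \<Gamma>"
    and "\<eta> \<in> Cc_infinity (ball 0 1)"
    and "\<And>x. x \<in> ball 0 (3/4) \<Longrightarrow> \<eta> x = 1"
    and "\<And>D. D \<in> packages \<Lambda> X \<Longrightarrow> u D \<in> Lp_fun 3 (cyl (ball 0 1))"
    and "\<And>D E c d. D \<in> packages \<Lambda> X \<Longrightarrow> E \<in> packages \<Lambda> X \<Longrightarrow>
      AE z in lborel. z \<in> cyl (ball 0 1) \<longrightarrow> u (pkg_comb c D d E) z = c *\<^sub>R u D z + d *\<^sub>R u E z"
    and "\<And>D. D \<in> packages \<Lambda> X \<Longrightarrow> F_cl U R D \<in> Lp_fun (3/2) (cyl (ball 0 1))"
    and "P o\<^sub>L P = P"
    and "Pi_harm o\<^sub>L Pi_harm = Pi_harm"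
    and "\<exists>B. finite B \<and> range (blinfun_apply Pi_harm) = span B"
    and "\<And>v :: spacetime \<Rightarrow> real ^ 3. v \<in> Lp_fun 3 (cyl (ball 0 1)) \<Longrightarrow>
      norm (restrict_yprs (RR (cutoff_tensor \<eta> (outer v)))
            - restrict_yprs (cutoff_mult \<eta> (RR (outer v))))
        \<le> C_\<eta> * (Lp_norm 3 (cyl annulus) v)\<^sup>2"
    and "\<And>M :: spacetime \<Rightarrow> real ^ 3 ^ 3. M \<in> Lp_fun (3/2) (cyl (ball 0 1)) \<Longrightarrow>
      norm (restrict_yprs (RR M)) \<le> C_Riesz * Lp_norm (3/2) (cyl (ball 0 1)) M"
    and "0 < \<alpha>_proj" and "0 < \<alpha>_harm"
    and "0 \<le> \<eta>_core" and "0 \<le> \<Delta>_core"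
    and "\<And>D. D \<in> packages \<Lambda> X \<Longrightarrow> \<exists>\<zeta>\<in>\<Gamma>.
      dist_tail \<Lambda> a \<Gamma> \<alpha>_proj \<alpha>_harm U R p_harm P Pi_harm J D =
        norm_loc \<Lambda> a (pkg_diff D \<zeta>) + \<alpha>_proj * T_proj U R P D \<zeta> + \<alpha>_harm * T_harm p_harm Pi_harm J D \<zeta> \<and>
      2 * C_\<eta> * (Lp_norm 3 (cyl annulus) (u (pkg_diff D \<zeta>)))\<^sup>2
        + C_Riesz * Lp_norm (3/2) (cyl (ball 0 1)) (M_act \<eta> u U R (pkg_diff D \<zeta>))
        \<le> \<eta>_core * dist_tail \<Lambda> a \<Gamma> \<alpha>_proj \<alpha>_harm U R p_harm P Pi_harm J D + \<Delta>_core"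
  shows "\<forall>D\<in>packages \<Lambda> X.
    Err_src \<Gamma> \<eta> u U R p_harm P Pi_harm J D
      \<le> (\<eta>_core + max (inverse \<alpha>_proj) (inverse \<alpha>_harm))
           * dist_tail \<Lambda> a \<Gamma> \<alpha>_proj \<alpha>_harm U R p_harm P Pi_harm J D + \<Delta>_core"
proof
  fix D assume D: "D \<in> packages \<Lambda> X"
  let ?d = "dist_tail \<Lambda> a \<Gamma> \<alpha>_proj \<alpha>_harm U R p_harm P Pi_harm J D"
  obtain \<zeta> where \<zeta>: "\<zeta> \<in> \<Gamma>"
    and d: "?d = norm_loc \<Lambda> a (pkg_diff D \<zeta>) + \<alpha>_proj * T_proj U R P D \<zeta>
      + \<alpha>_harm * T_harm p_harm Pi_harm J D \<zeta>"
    and core: "2 * C_\<eta> * (Lp_norm 3 (cyl annulus) (u (pkg_diff D \<zeta>)))\<^sup>2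
        + C_Riesz * Lp_norm (3/2) (cyl (ball 0 1)) (M_act \<eta> u U R (pkg_diff D \<zeta>))
        \<le> \<eta>_core * ?d + \<Delta>_core"
    using assms(19)[OF D] by blast
  let ?E = "pkg_diff D \<zeta>"
  \<comment> \<open>The integrability hypotheses are stated for packages only, so they become
    available at the corrected package here.\<close>
  have E: "?E \<in> packages \<Lambda> X"
    using pkg_diff_packages[OF assms(2) D] \<zeta> assms(4) by (auto simp: pkg_subspace_def)
  note uE = assms(7)[OF E] and FE = assms(9)[OF E]
  \<comment> \<open>No sign of \<open>C_\<eta>\<close> is assumed; the product is nonnegative
    because the commutator estimate bounds a norm by it.\<close>
  have annular: "0 \<le> C_\<eta> * (Lp_norm 3 (cyl annulus) (u ?E))\<^sup>2"
    by (rule order_trans[OF norm_ge_zero assms(13)[OF uE]])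
  have active: "norm (restrict_yprs (RR (M_act \<eta> u U R ?E)))
      \<le> C_Riesz * Lp_norm (3/2) (cyl (ball 0 1)) (M_act \<eta> u U R ?E)"
    by (rule assms(14)[OF M_act_Lp_fun[where u=u, OF assms(5) uE FE]])
  have "0 \<le> norm_loc \<Lambda> a ?E"
    unfolding norm_loc_def
    by (intro real_sqrt_ge_zero sum_nonneg mult_nonneg_nonneg less_imp_le[OF assms(3)]) auto
  then have tails: "T_proj U R P D \<zeta> + T_harm p_harm Pi_harm J D \<zeta>
      \<le> max (inverse \<alpha>_proj) (inverse \<alpha>_harm) * ?d"
    unfolding d
    by (intro add_le_max_inverse_mult assms(15,16)) (simp_all add: T_proj_def T_harm_def)
  have "Err_src \<Gamma> \<eta> u U R p_harm P Pi_harm J D \<le> norm (P_src \<eta> u U R p_harm P Pi_harm J ?E)"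
    \<comment> \<open>A real infimum lies below its values only for a set bounded below; norms give
      the bound 0.\<close>
    unfolding Err_src_def by (intro cINF_lower \<zeta> bdd_belowI2[of _ 0]) simp
  also have "\<dots> \<le> norm (restrict_yprs (RR (M_act \<eta> u U R ?E)))
      + T_proj U R P D \<zeta> + T_harm p_harm Pi_harm J D \<zeta>"
    unfolding T_proj_def T_harm_def by (rule norm_P_src_le[where u=u, OF assms(5) uE FE])
  also have "\<dots> \<le> (\<eta>_core * ?d + \<Delta>_core) + max (inverse \<alpha>_proj) (inverse \<alpha>_harm) * ?d"
    \<comment> \<open>Dropping twice the \<open>annular\<close> quantity from \<open>core\<close>
      leaves the bound for the \<open>active\<close> term.\<close>
    using annular active core tails by linarith
  finally show "Err_src \<Gamma> \<eta> u U R p_harm P Pi_harm J D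
      \<le> (\<eta>_core + max (inverse \<alpha>_proj) (inverse \<alpha>_harm)) * ?d + \<Delta>_core"
    by (simp add: distrib_right)
qed

end
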